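(* Let $(M,d)$ be an Alexandrov NPC space. Then $(M,d)$ satisfies the double-projection property.
   Context: Let $(M,d)$ be a metric space. Geodesics. The length of a continuous curve $\gamma:[0,1]\to M$ is $l(\gamma)=\sup\{\sum_{i=1}^m d(\gamma(t_{i-1}),\gamma(t_i)) : 0=t_0<\dots<t_m=1,\ m\in\mathbb N\}$. A geodesic segment joining $p$ to $q$ is a continuous curve $\gamma:[0,1]\to M$ with $\gamma(0)=p$, $\gamma(1)=q$ and $l(\gamma)=d(p,q)$, parametrized proportionally to arc-length. $(M,d)$ is a geodesic length space if every two points $p,q\in M$ are joined by a geodesic segment. A set $S\subset M$ is geodesic convex if for every two points $p,q\in S$ there exists a unique geodesic segment joining $p$ to $q$ whose image is contained in $S$. CAT(0) and Alexandrov NPC spaces. A geodesic triangle $\Delta(p,q,r)$ consists of three points $p,q,r$ and a choice of three geodesic segments (sides) joining them pairwise. A comparison triangle $\overline\Delta(\overline p,\overline q,\overline r)$ is a triangle in the Euclidean plane $\mathbb R^2$ with the same corresponding side lengths. If $x$ lies on a side of $\Delta(p,q,r)$ starting at the vertex $p$, its comparison point is the point $\overline x$ on the corresponding side of $\overline\Delta$ whose Euclidean distance from $\overline p$ equals $d(p,x)$ (similarly for the other sides). A geodesic length space is a CAT$(0)$-space if for every geodesic triangle $\Delta$ and all $x,y\in\Delta$, with comparison points $\overline x,\overline y$, one has $d(x,y)\le |\overline x-\overline y|$. $(M,d)$ is an Alexandrov NPC space if for every $p\in M$ there exists $\rho_p>0$ such that the ball $B(p,\rho_p)=\{q\in M: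 d(p,q)<\rho_p\}$ (with the metric $d$) is a CAT$(0)$-space. Metric projection. For a nonempty set $S\subset M$ and $q\in M$, $P_S(q)=\{s\in S: d(q,s)=\inf_{z\in S}d(q,z)\}$. If $S\subset U\subset M$, then $S$ is $U$-proximinal if $P_S(q)\ne\emptyset$ for every $q\in U$. For sets $S_1,S_2$, $(P_{S_1}\circ P_{S_2})(q)=\bigcup_{s\in P_{S_2}(q)}P_{S_1}(s)$. Double-projection property. $(M,d)$ satisfies the double-projection property if every point $p\in M$ has a neighborhood $U\subset M$ such that $(U,d)$ is a geodesic length space, and for every two (nonempty) geodesic convex, $U$-proximinal sets $S_1,S_2\subset U$ and every $q\in S_1$ the following two statements are equivalent: $(DP_1)$ $q\in (P_{S_1}\circ P_{S_2})(q)$; $(DP_2)$ there exists $\tilde q\in P_{S_2}(q)$ such that $d(q,\tilde q)\le d(z_1,z_2)$ for all $z_1\in S_1$, $z_2\in S_2$. *)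

theory Defs
  imports "HOL-Analysis.Analysis"
begin

text \<open>A metric space \<open>(M, d)\<close> is a set \<open>M\<close> in a type of class \<^class>\<open>metric_space\<close>, carrying the
  restriction of \<^const>\<open>dist\<close>; its subspaces \<open>(U, d)\<close> are then simply the subsets of \<open>M\<close>.\<close>

section \<open>Geodesics\<close>

text \<open>The case \<open>m = 0\<close> contributes only when \<open>a = b\<close>, where the length is \<open>0\<close>.\<close>

definition curve_length :: "(real \<Rightarrow> 'a::metric_space) \<Rightarrow> real \<Rightarrow> real \<Rightarrow> ereal" where
  "curve_length \<gamma> a b =
     Sup {ereal (\<Sum>i=1..m. dist (\<gamma> (t (i - 1))) (\<gamma> (t i))) | (m::nat) (t :: nat \<Rightarrow> real).
            t 0 = a \<and> t m = b \<and> (\<forall>i\<in>{1..m}. t (i - 1) < t i)}"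

text \<open>The last conjunct is parametrization proportional to arc-length.\<close>

definition geodesic_segment ::
    "'a::metric_space set \<Rightarrow> 'a \<Rightarrow> 'a \<Rightarrow> (real \<Rightarrow> 'a) \<Rightarrow> bool" where
  "geodesic_segment X p q \<gamma> \<longleftrightarrow>
     path \<gamma> \<and> path_image \<gamma> \<subseteq> X \<and> pathstart \<gamma> = p \<and> pathfinish \<gamma> = q \<and>
     curve_length \<gamma> 0 1 = ereal (dist p q) \<and>
     (\<forall>t\<in>{0..1}. curve_length \<gamma> 0 t = ereal t * curve_length \<gamma> 0 1)"

definition geodesic_length_space :: "'a::metric_space set \<Rightarrow> bool" where
  "geodesic_length_space X \<longleftrightarrow> (\<forall>p\<in>X. \<forall>q\<in>X. \<exists>\<gamma>. geodesic_segment X p q \<gamma>)"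

text \<open>Curves are total functions on the reals, so uniqueness means agreement on \<open>[0, 1]\<close>.\<close>

definition geodesic_convex :: "'a::metric_space set \<Rightarrow> bool" where
  "geodesic_convex S \<longleftrightarrow>
     (\<forall>p\<in>S. \<forall>q\<in>S. \<exists>\<gamma>. geodesic_segment S p q \<gamma> \<and>
        (\<forall>\<gamma>'. geodesic_segment S p q \<gamma>' \<longrightarrow> (\<forall>t\<in>{0..1}. \<gamma>' t = \<gamma> t)))"

section \<open>CAT(0) and Alexandrov NPC spaces\<close>

text \<open>The sides \<open>\<alpha>\<close>, \<open>\<beta>\<close>, \<open>\<gamma>\<close> run from \<open>p\<close> to \<open>q\<close>, from \<open>q\<close> to \<open>r\<close> and from \<open>r\<close> to \<open>p\<close>.\<close>

definition geodesic_triangle ::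
    "'a::metric_space set \<Rightarrow> 'a \<Rightarrow> 'a \<Rightarrow> 'a \<Rightarrow>
     (real \<Rightarrow> 'a) \<Rightarrow> (real \<Rightarrow> 'a) \<Rightarrow> (real \<Rightarrow> 'a) \<Rightarrow> bool" where
  "geodesic_triangle X p q r \<alpha> \<beta> \<gamma> \<longleftrightarrow> p \<in> X \<and> q \<in> X \<and> r \<in> X \<and>
     geodesic_segment X p q \<alpha> \<and> geodesic_segment X q r \<beta> \<and> geodesic_segment X r p \<gamma>"

definition comparison_triangle ::
    "'a::metric_space \<Rightarrow> 'a \<Rightarrow> 'a \<Rightarrow> real^2 \<Rightarrow> real^2 \<Rightarrow> real^2 \<Rightarrow> bool" where
  "comparison_triangle p q r p' q' r' \<longleftrightarrow>
     dist p' q' = dist p q \<and> dist q' r' = dist q r \<and> dist r' p' = dist r p"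

definition comparison_point_on_side ::
    "(real \<Rightarrow> 'a::metric_space) \<Rightarrow> real^2 \<Rightarrow> real^2 \<Rightarrow> 'a \<Rightarrow> real^2 \<Rightarrow> bool" where
  "comparison_point_on_side \<gamma> a b x x' \<longleftrightarrow>
     x \<in> path_image \<gamma> \<and> x' \<in> closed_segment a b \<and> dist a x' = dist (pathstart \<gamma>) x"

text \<open>A point lying on several sides has a comparison point for each of them, so this is a
  relation rather than a function of \<open>x\<close>.\<close>

definition comparison_point ::
    "(real \<Rightarrow> 'a::metric_space) \<Rightarrow> (real \<Rightarrow> 'a) \<Rightarrow> (real \<Rightarrow> 'a) \<Rightarrow>
     real^2 \<Rightarrow> real^2 \<Rightarrow> real^2 \<Rightarrow> 'a \<Rightarrow> real^2 \<Rightarrow> bool" where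
  "comparison_point \<alpha> \<beta> \<gamma> p' q' r' x x' \<longleftrightarrow>
     comparison_point_on_side \<alpha> p' q' x x' \<or>
     comparison_point_on_side \<beta> q' r' x x' \<or>
     comparison_point_on_side \<gamma> r' p' x x'"

definition CAT0_space :: "'a::metric_space set \<Rightarrow> bool" where
  "CAT0_space X \<longleftrightarrow> geodesic_length_space X \<and>
     (\<forall>p q r \<alpha> \<beta> \<gamma> p' q' r' x y x' y'.
        geodesic_triangle X p q r \<alpha> \<beta> \<gamma> \<longrightarrow>
        comparison_triangle p q r p' q' r' \<longrightarrow>
        comparison_point \<alpha> \<beta> \<gamma> p' q' r' x x' \<longrightarrow>
        comparison_point \<alpha> \<beta> \<gamma> p' q' r' y y' \<longrightarrow>
        dist x y \<le> dist x' y')"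

definition Alexandrov_NPC_space :: "'a::metric_space set \<Rightarrow> bool" where
  "Alexandrov_NPC_space M \<longleftrightarrow> (\<forall>p\<in>M. \<exists>\<rho>>0. CAT0_space {q\<in>M. dist p q < \<rho>})"

section \<open>Metric projections and the double-projection property\<close>

definition metric_projection :: "'a::metric_space set \<Rightarrow> 'a \<Rightarrow> 'a set" where
  "metric_projection S q = {s\<in>S. dist q s = (INF z\<in>S. dist q z)}"

definition proximinal :: "'a::metric_space set \<Rightarrow> 'a set \<Rightarrow> bool" where
  "proximinal U S \<longleftrightarrow> S \<subseteq> U \<and> (\<forall>q\<in>U. metric_projection S q \<noteq> {})"

definition DP1 :: "'a::metric_space set \<Rightarrow> 'a set \<Rightarrow> 'a \<Rightarrow> bool" where
  "DP1 S1 S2 q \<longleftrightarrow> q \<in> (\<Union>s\<in>metric_projection S2 q. metric_projection S1 s)"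

definition DP2 :: "'a::metric_space set \<Rightarrow> 'a set \<Rightarrow> 'a \<Rightarrow> bool" where
  "DP2 S1 S2 q \<longleftrightarrow>
     (\<exists>q'\<in>metric_projection S2 q. \<forall>z1\<in>S1. \<forall>z2\<in>S2. dist q q' \<le> dist z1 z2)"

text \<open>Neighborhoods are taken in \<open>M\<close> and need not be open.\<close>

definition double_projection_property :: "'a::metric_space set \<Rightarrow> bool" where
  "double_projection_property M \<longleftrightarrow>
     (\<forall>p\<in>M. \<exists>U. U \<subseteq> M \<and> (\<exists>W. openin (top_of_set M) W \<and> p \<in> W \<and> W \<subseteq> U) \<and>
        geodesic_length_space U \<and>
        (\<forall>S1 S2. S1 \<noteq> {} \<and> S2 \<noteq> {} \<and>
           geodesic_convex S1 \<and> geodesic_convex S2 \<and> proximinal U S1 \<and> proximinal U S2 \<longrightarrow>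
           (\<forall>q\<in>S1. DP1 S1 S2 q \<longleftrightarrow> DP2 S1 S2 q)))"

end

theory Submission
  imports Defs
begin

text \<open>
  Every point of an Alexandrov NPC space is the centre of a ball \<open>U\<close> that is a CAT(0)-space; this
  ball is the required neighbourhood.  That \<open>(DP\<^sub>2)\<close> implies \<open>(DP\<^sub>1)\<close> holds in any metric space: if
  \<open>d(q, s)\<close> is minimal among all distances between the two sets, then in particular it is minimal
  among the distances from \<open>s\<close> to the first set.

  For the converse let \<open>s\<close> be a nearest point of \<open>S\<^sub>2\<close> to \<open>q\<close> and \<open>q\<close> a nearest point of \<open>S\<^sub>1\<close> to
  \<open>s\<close>, and let \<open>z\<^sub>1 \<in> S\<^sub>1\<close>, \<open>z\<^sub>2 \<in> S\<^sub>2\<close>.  Geometrically, the quadrilateral \<open>q, s, z\<^sub>2, z\<^sub>1\<close> has angles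
  of at least \<open>\<pi>/2\<close> at \<open>q\<close> and at \<open>s\<close>, so the side \<open>z\<^sub>1 z\<^sub>2\<close> opposite to \<open>q s\<close> cannot be shorter than
  it.  Angles can be avoided: in terms of squared distances the two angle conditions
  (lemma \<open>projection_obtuse\<close>) read
  \<open>d(s, z\<^sub>1)\<^sup>2 \<ge> d(s, q)\<^sup>2 + d(q, z\<^sub>1)\<^sup>2\<close> and \<open>d(q, z\<^sub>2)\<^sup>2 \<ge> d(q, s)\<^sup>2 + d(s, z\<^sub>2)\<^sup>2\<close>,
  whereas in a CAT(0)-space the squared diagonals of a quadrilateral add up to at most the sum of
  the four squared sides (lemma \<open>CAT0_quadrilateral\<close>).  Adding up, \<open>2 d(q, s)\<^sup>2\<close> is at most
  \<open>d(q, s)\<^sup>2 + d(z\<^sub>1, z\<^sub>2)\<^sup>2\<close>, which is the claim.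

  Both ingredients follow from the inequality of Bruhat and Tits (lemma \<open>CAT0_Bruhat_Tits\<close>), which
  bounds the distance from a vertex of a geodesic triangle to a point of the opposite side by the
  value that Stewart's theorem gives in the comparison triangle.
\<close>

section \<open>Distances along a geodesic segment\<close>

text \<open>A partition of \<open>[a, b]\<close> followed by the point \<open>c\<close> is a partition of \<open>[a, c]\<close>.\<close>

lemma curve_length_add_chord_le:
  assumes "b < c"
  shows "curve_length \<gamma> a b + ereal (dist (\<gamma> b) (\<gamma> c)) \<le> curve_length \<gamma> a c"
proof -
  have "curve_length \<gamma> a b \<le> curve_length \<gamma> a c - ereal (dist (\<gamma> b) (\<gamma> c))"
    unfolding curve_length_def[of \<gamma> a b]
  proof (rule Sup_least, clarify)
    fix m :: nat and t :: "nat \<Rightarrow> real"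
    assume t: "a = t 0" "b = t m" "\<forall>i\<in>{1..m}. t (i - 1) < t i"
    define u where "u = t(Suc m := c)"
    have "ereal (\<Sum>i=1..Suc m. dist (\<gamma> (u (i - 1))) (\<gamma> (u i))) \<le> curve_length \<gamma> a c"
      unfolding curve_length_def
    proof (rule Sup_upper, rule CollectI, intro exI conjI ballI)
      fix i assume "i \<in> {1..Suc m}"
      then show "u (i - 1) < u i"
        using t assms by (cases "i = Suc m") (auto simp: u_def)
    qed (use t in \<open>auto simp: u_def\<close>)
    moreover have "(\<Sum>i=1..Suc m. dist (\<gamma> (u (i - 1))) (\<gamma> (u i)))
        = (\<Sum>i=1..m. dist (\<gamma> (t (i - 1))) (\<gamma> (t i))) + dist (\<gamma> b) (\<gamma> c)"
      using t by (auto simp: u_def intro!: sum.cong)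
    ultimately show "ereal (\<Sum>i=1..m. dist (\<gamma> (t (i - 1))) (\<gamma> (t i)))
        \<le> curve_length \<gamma> (t 0) c - ereal (dist (\<gamma> (t m)) (\<gamma> c))"
      using t by (simp add: ereal_le_minus)
  qed
  then show ?thesis
    by (simp add: ereal_le_minus)
qed

lemma chord_le_curve_length:
  assumes "a < b"
  shows "ereal (dist (\<gamma> a) (\<gamma> b)) \<le> curve_length \<gamma> a b"
  unfolding curve_length_def
proof (rule Sup_upper, rule CollectI, intro exI conjI)
  let ?t = "\<lambda>i. if i = 0 then a else b"
  show "ereal (dist (\<gamma> a) (\<gamma> b)) = ereal (\<Sum>i=1..1::nat. dist (\<gamma> (?t (i - 1))) (\<gamma> (?t i)))"
    by simp
qed (use assms in auto)

lemma geodesic_segment_ends: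
  assumes "geodesic_segment X p q \<gamma>"
  shows "\<gamma> 0 = p" "\<gamma> 1 = q"
  using assms unfolding geodesic_segment_def pathstart_def pathfinish_def by blast+

lemma geodesic_segment_image:
  "geodesic_segment X p q \<gamma> \<Longrightarrow> t \<in> {0..1} \<Longrightarrow> \<gamma> t \<in> X"
  unfolding geodesic_segment_def path_image_def by blast

text \<open>The length is shared out in the ratio \<open>t : 1 - t\<close> between the two pieces of the curve; their
  chords cannot be shorter than their lengths, because together they reach from \<open>p\<close> to \<open>q\<close>.\<close>

lemma geodesic_segment_dist:
  assumes "geodesic_segment X p q \<gamma>" "t \<in> {0..1}"
  shows "dist p (\<gamma> t) = t * dist p q" "dist (\<gamma> t) q = (1 - t) * dist p q"
proof -
  have ends: "\<gamma> 0 = p" "\<gamma> 1 = q"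
    using geodesic_segment_ends[OF assms(1)] .
  have len: "curve_length \<gamma> 0 t = ereal (t * dist p q)" "curve_length \<gamma> 0 1 = ereal (dist p q)"
    using assms by (auto simp: geodesic_segment_def)
  have 1: "dist p (\<gamma> t) \<le> t * dist p q"
    using chord_le_curve_length[of 0 t \<gamma>] assms(2) ends len by (cases "t = 0") auto
  have 2: "dist (\<gamma> t) q \<le> (1 - t) * dist p q"
    using curve_length_add_chord_le[of t 1 \<gamma> 0] assms(2) ends len
    by (cases "t = 1") (auto simp: algebra_simps)
  have "dist p q \<le> dist p (\<gamma> t) + dist (\<gamma> t) q"
    by (rule dist_triangle)
  with 1 2 show "dist p (\<gamma> t) = t * dist p q" "dist (\<gamma> t) q = (1 - t) * dist p q"
    by (auto simp: algebra_simps)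
qed

lemma geodesic_segment_mono:
  "geodesic_segment X p q \<gamma> \<Longrightarrow> X \<subseteq> Y \<Longrightarrow> geodesic_segment Y p q \<gamma>"
  unfolding geodesic_segment_def by blast

section \<open>Comparison triangles and the inequality of Bruhat and Tits\<close>

text \<open>With \<open>p'\<close> at the origin and \<open>q'\<close> on the first axis, the law of cosines dictates the first
  coordinate of \<open>r'\<close>, and the triangle inequalities say that it is at most \<open>d(p, r)\<close> in absolute
  value.\<close>

lemma comparison_triangle_exists:
  fixes p q r :: "'a::metric_space"
  obtains p' q' r' where "comparison_triangle p q r p' q' r'"
proof -
  define a b c where "a = dist q r" and "b = dist r p" and "c = dist p q"
  have tri: "a \<le> b + c" "b \<le> a + c" "c \<le> a + b" and nonneg: "a \<ge> 0" "b \<ge> 0" "c \<ge> 0"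
    using dist_triangle[of q r p] dist_triangle[of r p q] dist_triangle[of p q r]
    by (auto simp: a_def b_def c_def dist_commute)
  \<comment> \<open>If \<open>p = q\<close>, then \<open>x = 0\<close> by the convention for division by zero, and \<open>r'\<close> lies on the second
    axis, at distance \<open>b = a\<close> from both other vertices.\<close>
  define x where "x = (b\<^sup>2 + c\<^sup>2 - a\<^sup>2) / (2 * c)"
  have x_eq: "2 * c * x = b\<^sup>2 + c\<^sup>2 - a\<^sup>2"
    using tri nonneg by (cases "c = 0") (auto simp: x_def)
  have "\<bar>x\<bar> \<le> b"
  proof (cases "c = 0")
    case False
    have "0 \<le> (a + (c - b)) * (a - (c - b))" "0 \<le> ((b + c) + a) * ((b + c) - a)"
      using tri nonneg by (auto intro!: mult_nonneg_nonneg)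
    then have "2 * c * x \<le> 2 * c * b" "2 * c * (- b) \<le> 2 * c * x"
      unfolding x_eq by (auto simp: power2_eq_square algebra_simps)
    moreover have "0 < 2 * c"
      using False nonneg by simp
    ultimately have "x \<le> b" "- b \<le> x"
      by (blast intro: mult_left_le_imp_le)+
    then show ?thesis
      by simp
  qed (use nonneg in \<open>simp add: x_def\<close>)
  then have x_le: "x\<^sup>2 \<le> b\<^sup>2"
    using abs_le_square_iff[of x b] nonneg by simp
  define y where "y = sqrt (b\<^sup>2 - x\<^sup>2)"
  have y_sq: "y\<^sup>2 = b\<^sup>2 - x\<^sup>2"
    using x_le by (simp add: y_def)
  have cx: "(c - x)\<^sup>2 + y\<^sup>2 = a\<^sup>2"
    using x_eq unfolding y_sq by (simp add: power2_eq_square algebra_simps)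
  have "comparison_triangle p q r (vector [0, 0]) (vector [c, 0]) (vector [x, y] :: real^2)"
    using nonneg cx y_sq
    by (simp add: comparison_triangle_def dist_vec_def L2_set_def sum_2 dist_real_def
        a_def [symmetric] b_def [symmetric] c_def [symmetric])
  then show thesis
    by (rule that)
qed

text \<open>Stewart's theorem, obtained by expanding the square of \<open>(1 - t)(r - p) + t(r - q)\<close> and
  eliminating the mixed inner product in favour of \<open>d(p, q)\<^sup>2\<close>.\<close>

lemma dist_convex_combination_sq:
  fixes p q r :: "'a::real_inner"
  shows "(dist r ((1 - t) *\<^sub>R p + t *\<^sub>R q))\<^sup>2
    = (1 - t) * (dist r p)\<^sup>2 + t * (dist r q)\<^sup>2 - t * (1 - t) * (dist p q)\<^sup>2"
proof -
  define u v where "u = r - p" and "v = r - q"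
  have "r - ((1 - t) *\<^sub>R p + t *\<^sub>R q) = (1 - t) *\<^sub>R u + t *\<^sub>R v" and "p - q = v - u"
    by (simp_all add: u_def v_def algebra_simps)
  moreover have "inner ((1 - t) *\<^sub>R u + t *\<^sub>R v) ((1 - t) *\<^sub>R u + t *\<^sub>R v)
      = (1 - t) * inner u u + t * inner v v - t * (1 - t) * inner (v - u) (v - u)"
    by (simp add: inner_add inner_diff inner_commute[of v u]) algebra
  ultimately show ?thesis
    unfolding dist_norm power2_norm_eq_inner u_def v_def by simp
qed

lemma CAT0_Bruhat_Tits:
  assumes "CAT0_space X" "geodesic_segment X p q \<gamma>" "r \<in> X" "t \<in> {0..1}"
  shows "(dist r (\<gamma> t))\<^sup>2
    \<le> (1 - t) * (dist r p)\<^sup>2 + t * (dist r q)\<^sup>2 - t * (1 - t) * (dist p q)\<^sup>2"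
proof -
  have pq: "p \<in> X" "q \<in> X"
    using geodesic_segment_ends[OF assms(2)] geodesic_segment_image[OF assms(2)]
    by (metis atLeastAtMost_iff order_refl zero_le_one)+
  obtain \<beta> \<delta> where \<beta>: "geodesic_segment X q r \<beta>" and \<delta>: "geodesic_segment X r p \<delta>"
    using assms(1,3) pq unfolding CAT0_space_def geodesic_length_space_def by metis
  have tri: "geodesic_triangle X p q r \<gamma> \<beta> \<delta>"
    using assms \<beta> \<delta> pq by (simp add: geodesic_triangle_def)
  obtain p' q' r' where comp: "comparison_triangle p q r p' q' r'"
    by (rule comparison_triangle_exists)
  define x' where "x' = (1 - t) *\<^sub>R p' + t *\<^sub>R q'"
  have "x' \<in> closed_segment p' q'"
    using assms(4) by (auto simp: x'_def closed_segment_def)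
  moreover have "dist p' x' = t * dist p' q'"
  proof -
    have "p' - x' = t *\<^sub>R (p' - q')"
      by (simp add: x'_def algebra_simps)
    then show ?thesis
      using assms(4) by (simp add: dist_norm)
  qed
  ultimately have "comparison_point_on_side \<gamma> p' q' (\<gamma> t) x'"
    using assms(4) geodesic_segment_ends[OF assms(2)] comp geodesic_segment_dist(1)[OF assms(2,4)]
    by (auto simp: comparison_point_on_side_def comparison_triangle_def path_image_def
        pathstart_def)
  then have "comparison_point \<gamma> \<beta> \<delta> p' q' r' (\<gamma> t) x'"
    by (simp add: comparison_point_def)
  moreover have "comparison_point_on_side \<beta> q' r' r r'"
    using geodesic_segment_ends[OF \<beta>] comp
    by (auto simp: comparison_point_on_side_def comparison_triangle_def path_image_def
        pathstart_def image_iff intro!: bexI[of _ 1])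
  then have "comparison_point \<gamma> \<beta> \<delta> p' q' r' r r'"
    by (simp add: comparison_point_def)
  ultimately have "dist r (\<gamma> t) \<le> dist r' x'"
    using assms(1) tri comp unfolding CAT0_space_def by blast
  then have "(dist r (\<gamma> t))\<^sup>2 \<le> (dist r' x')\<^sup>2"
    by (simp add: power_mono)
  also have "\<dots> = (1 - t) * (dist r p)\<^sup>2 + t * (dist r q)\<^sup>2 - t * (1 - t) * (dist p q)\<^sup>2"
    unfolding x'_def dist_convex_combination_sq
    using comp by (simp add: comparison_triangle_def dist_commute)
  finally show ?thesis .
qed

text \<open>The midpoint \<open>m\<close> of the diagonal \<open>a c\<close> is compared with \<open>b\<close> and with \<open>d\<close>; the other diagonal is
  at most \<open>d(b, m) + d(m, d)\<close>, whose square is at most twice the sum of the squares.\<close>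

lemma CAT0_quadrilateral:
  assumes "CAT0_space X" "a \<in> X" "b \<in> X" "c \<in> X" "d \<in> X"
  shows "(dist a c)\<^sup>2 + (dist b d)\<^sup>2
    \<le> (dist a b)\<^sup>2 + (dist b c)\<^sup>2 + (dist c d)\<^sup>2 + (dist d a)\<^sup>2"
proof -
  obtain \<gamma> where \<gamma>: "geodesic_segment X a c \<gamma>"
    using assms unfolding CAT0_space_def geodesic_length_space_def by metis
  define m where "m = \<gamma> (1/2)"
  have b: "(dist b m)\<^sup>2 \<le> (dist b a)\<^sup>2 / 2 + (dist b c)\<^sup>2 / 2 - (dist a c)\<^sup>2 / 4"
    using CAT0_Bruhat_Tits[OF assms(1) \<gamma> assms(3), of "1/2"] by (simp add: m_def)
  have d: "(dist d m)\<^sup>2 \<le> (dist d a)\<^sup>2 / 2 + (dist d c)\<^sup>2 / 2 - (dist a c)\<^sup>2 / 4"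
    using CAT0_Bruhat_Tits[OF assms(1) \<gamma> assms(5), of "1/2"] by (simp add: m_def)
  have "(dist b d)\<^sup>2 \<le> (dist b m + dist d m)\<^sup>2"
    by (rule power_mono[OF dist_triangle2]) simp
  also have "\<dots> \<le> 2 * (dist b m)\<^sup>2 + 2 * (dist d m)\<^sup>2"
    using zero_le_power2[of "dist b m - dist d m"] by (simp add: power2_sum power2_diff)
  finally show ?thesis
    using b d by (simp add: dist_commute)
qed

section \<open>Nearest points in geodesic convex sets\<close>

lemma metric_projection_iff:
  "s \<in> metric_projection S q \<longleftrightarrow> s \<in> S \<and> (\<forall>z\<in>S. dist q s \<le> dist q z)"
proof -
  have bdd: "bdd_below (dist q ` S)"
    by (rule bdd_belowI2[where m = 0]) simp
  show ?thesis
  proof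
    assume "s \<in> metric_projection S q"
    then show "s \<in> S \<and> (\<forall>z\<in>S. dist q s \<le> dist q z)"
      using cINF_lower[OF bdd] by (auto simp: metric_projection_def)
  next
    assume s: "s \<in> S \<and> (\<forall>z\<in>S. dist q s \<le> dist q z)"
    then have "dist q s = (INF z\<in>S. dist q z)"
      by (intro antisym cINF_greatest cINF_lower[OF bdd]) auto
    with s show "s \<in> metric_projection S q"
      by (simp add: metric_projection_def)
  qed
qed

text \<open>The first variation argument: moving from the nearest point \<open>q\<close> a little way towards \<open>z\<close> does
  not decrease the distance from \<open>s\<close>, so the angle at \<open>q\<close> is not acute.\<close>

lemma projection_obtuse:
  assumes "CAT0_space X" "S \<subseteq> X" "geodesic_convex S" "s \<in> X"
    and "q \<in> metric_projection S s" "z \<in> S"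
  shows "(dist s q)\<^sup>2 + (dist q z)\<^sup>2 \<le> (dist s z)\<^sup>2"
proof -
  have q: "q \<in> S" and nearest: "\<And>x. x \<in> S \<Longrightarrow> dist s q \<le> dist s x"
    using assms(5) by (auto simp: metric_projection_iff)
  obtain \<gamma> where \<gamma>: "geodesic_segment S q z \<gamma>"
    using assms(3,6) q unfolding geodesic_convex_def by metis
  have "(dist q z)\<^sup>2 \<le> (dist s z)\<^sup>2 - (dist s q)\<^sup>2"
  proof (rule field_le_mult_one_interval)
    fix u :: real
    assume u: "0 < u" "u < 1"
    define t where "t = 1 - u"
    have t: "0 < t" "t \<in> {0..1}"
      using u by (auto simp: t_def)
    have "\<gamma> t \<in> S"
      using geodesic_segment_image[OF \<gamma> t(2)] .
    then have "(dist s q)\<^sup>2 \<le> (dist s (\<gamma> t))\<^sup>2"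
      by (simp add: nearest power_mono)
    also have "\<dots> \<le> (1 - t) * (dist s q)\<^sup>2 + t * (dist s z)\<^sup>2 - t * (1 - t) * (dist q z)\<^sup>2"
      using CAT0_Bruhat_Tits[OF assms(1) geodesic_segment_mono[OF \<gamma> assms(2)] assms(4) t(2)] .
    finally have "t * (u * (dist q z)\<^sup>2) \<le> t * ((dist s z)\<^sup>2 - (dist s q)\<^sup>2)"
      by (simp add: t_def algebra_simps)
    then show "u * (dist q z)\<^sup>2 \<le> (dist s z)\<^sup>2 - (dist s q)\<^sup>2"
      using t(1) by simp
  qed
  then show ?thesis
    by simp
qed

section \<open>The double-projection property\<close>

lemma DP1_imp_DP2:
  assumes "CAT0_space X" "S1 \<subseteq> X" "S2 \<subseteq> X" "geodesic_convex S1" "geodesic_convex S2"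
    and "DP1 S1 S2 q"
  shows "DP2 S1 S2 q"
proof -
  obtain s where s: "s \<in> metric_projection S2 q" and q: "q \<in> metric_projection S1 s"
    using assms(6) by (auto simp: DP1_def)
  have in_X: "s \<in> X" "q \<in> X"
    using s q assms(2,3) by (auto simp: metric_projection_iff)
  have "dist q s \<le> dist z1 z2" if z: "z1 \<in> S1" "z2 \<in> S2" for z1 z2
  proof -
    have "(dist s q)\<^sup>2 + (dist q z1)\<^sup>2 \<le> (dist s z1)\<^sup>2"
      using projection_obtuse[OF assms(1,2,4) in_X(1) q z(1)] .
    moreover have "(dist q s)\<^sup>2 + (dist s z2)\<^sup>2 \<le> (dist q z2)\<^sup>2"
      using projection_obtuse[OF assms(1,3,5) in_X(2) s z(2)] .
    moreover have "(dist q z2)\<^sup>2 + (dist s z1)\<^sup>2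
        \<le> (dist q s)\<^sup>2 + (dist s z2)\<^sup>2 + (dist z2 z1)\<^sup>2 + (dist z1 q)\<^sup>2"
      using CAT0_quadrilateral[OF assms(1)] in_X z assms(2,3) by blast
    ultimately have "(dist q s)\<^sup>2 \<le> (dist z1 z2)\<^sup>2"
      by (simp only: dist_commute)
    then show ?thesis
      by (rule power2_le_imp_le) simp
  qed
  with s show ?thesis
    by (auto simp: DP2_def)
qed

lemma DP2_imp_DP1:
  assumes "q \<in> S1" "DP2 S1 S2 q"
  shows "DP1 S1 S2 q"
proof -
  obtain s where s: "s \<in> metric_projection S2 q"
    and le: "\<And>z1 z2. z1 \<in> S1 \<Longrightarrow> z2 \<in> S2 \<Longrightarrow> dist q s \<le> dist z1 z2"
    using assms(2) by (auto simp: DP2_def)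
  have "q \<in> metric_projection S1 s"
    using assms(1) s le by (auto simp: metric_projection_iff dist_commute)
  with s show ?thesis
    by (auto simp: DP1_def)
qed

theorem theorem2p1:
  fixes M :: "'a::metric_space set"
  assumes "Alexandrov_NPC_space M"
  shows "double_projection_property M"
  unfolding double_projection_property_def
proof
  fix p assume p: "p \<in> M"
  then obtain \<rho> where \<rho>: "\<rho> > 0" and cat: "CAT0_space {q\<in>M. dist p q < \<rho>}"
    using assms by (auto simp: Alexandrov_NPC_space_def)
  define U where "U = {q\<in>M. dist p q < \<rho>}"
  have U: "CAT0_space U" "U \<subseteq> M" "p \<in> U"
    using cat p \<rho> by (auto simp: U_def)
  have "U = M \<inter> ball p \<rho>"
    by (auto simp: U_def)
  then have "openin (top_of_set M) U"
    by (simp add: openin_open_Int)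
  moreover have "geodesic_length_space U"
    using U(1) by (simp add: CAT0_space_def)
  moreover have "DP1 S1 S2 q \<longleftrightarrow> DP2 S1 S2 q"
    if "geodesic_convex S1" "geodesic_convex S2" "proximinal U S1" "proximinal U S2" "q \<in> S1"
    for S1 S2 q
    using that DP1_imp_DP2[OF U(1)] DP2_imp_DP1 unfolding proximinal_def by blast
  ultimately show "\<exists>U. U \<subseteq> M \<and> (\<exists>W. openin (top_of_set M) W \<and> p \<in> W \<and> W \<subseteq> U) \<and>
        geodesic_length_space U \<and>
        (\<forall>S1 S2. S1 \<noteq> {} \<and> S2 \<noteq> {} \<and>
           geodesic_convex S1 \<and> geodesic_convex S2 \<and> proximinal U S1 \<and> proximinal U S2 \<longrightarrow>
           (\<forall>q\<in>S1. DP1 S1 S2 q \<longleftrightarrow> DP2 S1 S2 q))"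
    using U(2,3) by (intro exI[of _ U]) blast
qed

end
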